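(* If $r$ is a (fixed) positive integer, then for any positive constant $\alpha$, as $n\to\infty$, $$\mathbb{P}\big[\mathsf{min}(\mathbf{C}_{n,p})\ge r\big]\to\begin{cases}0,&\text{if } q\gg n^{-1},\\ e^{-\alpha r},&\text{if } q\sim\alpha n^{-1},\\ 1,&\text{if } n^{-1}\gg q.\end{cases}$$
   Context: An $n$-composition is a sequence of $n$ nonnegative integers. For $p=p(n)\in[0,1)$ and $q=1-p$, the geometric random composition $\mathbf{C}_{n,p}$ is the random $n$-composition whose terms are independent, with $\mathbb{P}[\mathbf{C}_{n,p}(i)=j]=qp^j$ for every $j\ge0$ and $i\in\{1,\dots,n\}$. $\mathsf{min}(C)$ denotes the smallest term of the composition $C$. For positive functions of $n$: $f\ll g$ (or $g\gg f$) means $\lim_{n\to\infty} f/g=0$, and $f\sim g$ means $\lim_{n\to\infty} f/g=1$. *)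

theory Defs
  imports "HOL-Probability.Product_PMF" "HOL-Library.Landau_Symbols"
begin

(* An n-composition is a function nat => nat whose terms are its values on {1..n}; it takes the
   default value 0 elsewhere. Note that the library's geometric_pmf is parametrised by the
   success probability, which is q = 1 - p here. *)
definition geometric_composition :: "nat \<Rightarrow> real \<Rightarrow> (nat \<Rightarrow> nat) pmf" where
  "geometric_composition n p = Pi_pmf {1..n} 0 (\<lambda>_. geometric_pmf (1 - p))"

definition min_term :: "nat \<Rightarrow> (nat \<Rightarrow> nat) \<Rightarrow> nat" where
  "min_term n C = Min (C ` {1..n})"

(* Only applied to eventually positive functions. *)
abbreviation much_less :: "(nat \<Rightarrow> real) \<Rightarrow> (nat \<Rightarrow> real) \<Rightarrow> bool" (infix "\<lless>" 50) where
  "f \<lless> g \<equiv> (\<lambda>n. f n / g n) \<longlonglongrightarrow> 0"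

lemma prob_geometric_composition_term:
  assumes "0 \<le> p" "p < 1" "i \<in> {1..n}"
  shows "measure_pmf.prob (geometric_composition n p) {C. C i = j} = (1 - p) * p ^ j"
proof -
  have "map_pmf (\<lambda>C. C i) (geometric_composition n p) = geometric_pmf (1 - p)"
    using assms by (simp add: geometric_composition_def Pi_pmf_component)
  moreover have "measure_pmf.prob (geometric_composition n p) {C. C i = j} =
      pmf (map_pmf (\<lambda>C. C i) (geometric_composition n p)) j"
    by (simp add: pmf_map vimage_def)
  ultimately show ?thesis
    using assms by simp
qed

lemma indep_geometric_composition_terms:
  "prob_space.indep_vars (measure_pmf (geometric_composition n p))
     (\<lambda>_. count_space UNIV) (\<lambda>i C. C i) {1..n}"
  unfolding geometric_composition_def by (rule indep_vars_Pi_pmf) simp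

end

theory Submission
  imports Defs
begin

text \<open>
  The terms are independent and each is at least \<open>r\<close> with probability \<open>p\<^sup>r\<close>, so the probability
  that the minimum is at least \<open>r\<close> is exactly \<open>(p\<^sup>r)\<^sup>n = ((1 - q)\<^sup>n)\<^sup>r\<close>
  (\<open>prob_min_term_ge\<close>). The whole statement is therefore about the limit of \<open>(1 - q)\<^sup>n\<close>,
  and this depends only on the limit of \<open>n q\<close>. The inequality \<open>1 + x \<le> exp x\<close>, used at
  \<open>x = - q\<close> and, for \<open>q < 1\<close>, at \<open>x = q / (1 - q)\<close>, gives
  \<open>exp (- n q / (1 - q)) \<le> (1 - q)\<^sup>n \<le> exp (- n q)\<close>.
  If \<open>n q\<close> tends to a finite \<open>c\<close>, then \<open>q\<close> tends to 0 and both bounds tend to \<open>exp (- c)\<close>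
  (\<open>one_minus_power_tendsto_exp\<close>); the cases \<open>c = \<alpha>\<close> and \<open>c = 0\<close> are the second and third
  regimes. If \<open>n q\<close> tends to infinity, the upper bound alone forces the limit 0
  (\<open>one_minus_power_tendsto_0\<close>), which is the first regime.
\<close>

lemma prob_geometric_pmf_atLeast:
  assumes "0 < q" "q \<le> 1"
  shows "measure_pmf.prob (geometric_pmf q) {r..} = (1 - q) ^ r"
proof -
  have "measure_pmf.prob (geometric_pmf q) {..<r} = q * (\<Sum>j<r. (1 - q) ^ j)"
    using assms by (simp add: measure_measure_pmf_finite sum_distrib_left mult.commute)
  also have "\<dots> = 1 - (1 - q) ^ r"
    using one_diff_power_eq[of "1 - q" r] by simp
  finally have "measure_pmf.prob (geometric_pmf q) {..<r} = 1 - (1 - q) ^ r" .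
  moreover have "{r..} = UNIV - {..<r}"
    by auto
  ultimately show ?thesis
    using measure_pmf.prob_compl[of "{..<r}" "geometric_pmf q"] by simp
qed

lemma prob_min_term_ge:
  assumes "n \<ge> 1" "0 \<le> p" "p < 1"
  shows "measure_pmf.prob (geometric_composition n p) {C. min_term n C \<ge> r} = (p ^ n) ^ r"
proof -
  have "{C. min_term n C \<ge> r} = Pi {1..n} (\<lambda>_. {r..})"
    using assms(1) by (auto simp: min_term_def)
  hence "measure_pmf.prob (geometric_composition n p) {C. min_term n C \<ge> r} =
      (\<Prod>i\<in>{1..n}. measure_pmf.prob (geometric_pmf (1 - p)) {r..})"
    by (simp only: geometric_composition_def measure_Pi_pmf_Pi finite_atLeastAtMost)
  also have "\<dots> = (p ^ n) ^ r"
    using assms by (simp add: prob_geometric_pmf_atLeast flip: power_mult) (simp add: mult.commute)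
  finally show ?thesis .
qed

lemma one_minus_power_le_exp:
  fixes x :: real
  assumes "x \<le> 1"
  shows "(1 - x) ^ n \<le> exp (- (real n * x))"
proof -
  have "(1 - x) ^ n \<le> exp (- x) ^ n"
    using assms exp_ge_add_one_self[of "- x"] by (intro power_mono) auto
  thus ?thesis
    by (simp flip: exp_of_nat_mult)
qed

text \<open>
  The reciprocal of \<open>1 - x\<close> is \<open>1 + x / (1 - x)\<close>, so an upper bound by the exponential for the
  reciprocal is a lower bound for \<open>1 - x\<close>.
\<close>

lemma exp_le_one_minus_power:
  fixes x :: real
  assumes "x < 1"
  shows "exp (- (real n * x / (1 - x))) \<le> (1 - x) ^ n"
proof -
  have "1 / (1 - x) \<le> exp (x / (1 - x))"
    using exp_ge_add_one_self[of "x / (1 - x)"] assms by (simp add: field_simps)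
  hence "exp (- (x / (1 - x))) \<le> 1 - x"
    using assms by (simp add: exp_minus field_simps)
  hence "exp (- (x / (1 - x))) ^ n \<le> (1 - x) ^ n"
    by (intro power_mono) auto
  thus ?thesis
    by (simp flip: exp_of_nat_mult)
qed

text \<open>
  The classical limit of \<open>(1 - c / n)\<^sup>n\<close>, with \<open>c\<close> allowed to vary with \<open>n\<close> as long as it converges.
\<close>

lemma one_minus_power_tendsto_exp:
  fixes x :: "nat \<Rightarrow> real"
  assumes lim: "(\<lambda>n. real n * x n) \<longlonglongrightarrow> c"
  shows "(\<lambda>n. (1 - x n) ^ n) \<longlonglongrightarrow> exp (- c)"
proof -
  have "(\<lambda>n. real n * x n * (1 / real n)) \<longlonglongrightarrow> c * 0"
    by (intro tendsto_mult lim lim_1_over_n)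
  moreover have "\<forall>\<^sub>F n in sequentially. real n * x n * (1 / real n) = x n"
    using eventually_gt_at_top[of 0] by eventually_elim simp
  ultimately have x0: "x \<longlonglongrightarrow> 0"
    using tendsto_cong by fastforce
  have less: "\<forall>\<^sub>F n in sequentially. x n < 1"
    using order_tendstoD(2)[OF x0, of 1] by simp
  show ?thesis
  proof (rule tendsto_sandwich)
    show "\<forall>\<^sub>F n in sequentially. exp (- (real n * x n / (1 - x n))) \<le> (1 - x n) ^ n"
      using less by eventually_elim (rule exp_le_one_minus_power)
    show "\<forall>\<^sub>F n in sequentially. (1 - x n) ^ n \<le> exp (- (real n * x n))"
      using less by eventually_elim (simp add: one_minus_power_le_exp)
    have "(\<lambda>n. exp (- (real n * x n / (1 - x n)))) \<longlonglongrightarrow> exp (- (c / (1 - 0)))"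
      by (intro tendsto_intros lim x0) simp
    thus "(\<lambda>n. exp (- (real n * x n / (1 - x n)))) \<longlonglongrightarrow> exp (- c)"
      by simp
    show "(\<lambda>n. exp (- (real n * x n))) \<longlonglongrightarrow> exp (- c)"
      by (intro tendsto_intros lim)
  qed
qed

lemma one_minus_power_tendsto_0:
  fixes x :: "nat \<Rightarrow> real"
  assumes lim: "filterlim (\<lambda>n. real n * x n) at_top sequentially"
    and le: "\<forall>\<^sub>F n in sequentially. x n \<le> 1"
  shows "(\<lambda>n. (1 - x n) ^ n) \<longlonglongrightarrow> 0"
proof (rule tendsto_sandwich)
  show "\<forall>\<^sub>F n in sequentially. 0 \<le> (1 - x n) ^ n"
    using le by eventually_elim simp
  show "\<forall>\<^sub>F n in sequentially. (1 - x n) ^ n \<le> exp (- (real n * x n))"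
    using le by eventually_elim (rule one_minus_power_le_exp)
  show "(\<lambda>n. exp (- (real n * x n))) \<longlonglongrightarrow> 0"
    by (rule filterlim_compose[OF exp_at_bot]) (use lim in \<open>simp add: filterlim_uminus_at_bot\<close>)
qed simp

theorem proposition4p12:
  fixes r :: nat and \<alpha> :: real and p q :: "nat \<Rightarrow> real"
  assumes "r \<ge> 1" and "\<alpha> > 0"
    and "\<And>n. n \<ge> 1 \<Longrightarrow> 0 \<le> p n \<and> p n < 1"
    and "\<And>n. q n = 1 - p n"
  defines "P \<equiv> \<lambda>n. measure_pmf.prob (geometric_composition n (p n)) {C. min_term n C \<ge> r}"
  shows "((\<lambda>n. 1 / real n) \<lless> q \<longrightarrow> P \<longlonglongrightarrow> 0)
       \<and> (q \<sim>[at_top] (\<lambda>n. \<alpha> * (1 / real n)) \<longrightarrow> P \<longlonglongrightarrow> exp (- \<alpha> * real r))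
       \<and> (q \<lless> (\<lambda>n. 1 / real n) \<longrightarrow> P \<longlonglongrightarrow> 1)"
proof -
  have pos: "\<forall>\<^sub>F n::nat in sequentially. n \<ge> 1"
    by (rule eventually_ge_at_top)
  have P_eq: "\<forall>\<^sub>F n in sequentially. ((1 - q n) ^ n) ^ r = P n"
    using pos
  proof eventually_elim
    case (elim n)
    thus ?case
      using assms(3)[of n] assms(4)[of n] by (simp add: P_def prob_min_term_ge)
  qed
  have limit_P: "P \<longlonglongrightarrow> l ^ r" if "(\<lambda>n. (1 - q n) ^ n) \<longlonglongrightarrow> l" for l
    using Lim_transform_eventually[OF tendsto_power[OF that, of r] P_eq] .
  show ?thesis
  proof (intro conjI impI)
    assume "(\<lambda>n. 1 / real n) \<lless> q"
    moreover have "\<forall>\<^sub>F n in sequentially. 0 < 1 / real n / q n"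
      using pos
    proof eventually_elim
      case (elim n)
      thus ?case
        using assms(3)[of n] assms(4)[of n] by simp
    qed
    ultimately have "filterlim (\<lambda>n. inverse (1 / real n / q n)) at_top sequentially"
      by (rule filterlim_inverse_at_top)
    hence "filterlim (\<lambda>n. real n * q n) at_top sequentially"
      by (simp add: field_simps)
    moreover have "\<forall>\<^sub>F n in sequentially. q n \<le> 1"
      using pos by eventually_elim (use assms(3,4) in auto)
    ultimately have "P \<longlonglongrightarrow> 0 ^ r"
      by (intro limit_P one_minus_power_tendsto_0)
    thus "P \<longlonglongrightarrow> 0"
      using assms(1) by (simp add: power_0_left)
  next
    assume "q \<sim>[at_top] (\<lambda>n. \<alpha> * (1 / real n))"
    hence "(\<lambda>n. real n * q n) \<sim>[at_top] (\<lambda>n. real n * (\<alpha> * (1 / real n)))"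
      by (intro asymp_equiv_intros)
    moreover have "(\<lambda>n. real n * (\<alpha> * (1 / real n))) \<longlonglongrightarrow> \<alpha>"
      by (rule tendsto_eventually) (use pos in eventually_elim, simp)
    ultimately have "(\<lambda>n. real n * q n) \<longlonglongrightarrow> \<alpha>"
      by (metis asymp_equiv_sym tendsto_asymp_equiv_cong)
    hence "P \<longlonglongrightarrow> exp (- \<alpha>) ^ r"
      by (intro limit_P one_minus_power_tendsto_exp)
    thus "P \<longlonglongrightarrow> exp (- \<alpha> * real r)"
      by (simp add: mult.commute flip: exp_of_nat_mult)
  next
    assume "q \<lless> (\<lambda>n. 1 / real n)"
    hence "(\<lambda>n. real n * q n) \<longlonglongrightarrow> 0"
      by (simp add: mult.commute)
    hence "P \<longlonglongrightarrow> exp (- 0) ^ r"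
      by (intro limit_P one_minus_power_tendsto_exp)
    thus "P \<longlonglongrightarrow> 1"
      by simp
  qed
qed

end
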